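(* For every integer $n$ with $1\le n\le 8$, $\mathrm{ex}(n,\overrightarrow{P_{1,3}})=2\,\mathrm{ex}(n,C_4)$, and $\mathrm{EX}(n,\overrightarrow{P_{1,3}})=\{\overleftrightarrow{H}: H\in \mathrm{EX}(n,C_4)\}$.
   Context: Graphs are finite and simple. Digraphs are finite and strict: no loops and no parallel arcs in the same direction, but both arcs $uv$ and $vu$ may be present. $C_4$ is the (undirected) cycle on $4$ vertices. $\overrightarrow{P_{1,3}}$ is the orientation of $C_4$ with four distinct vertices $a,b,c,d$ and arcs $ab$, $bc$, $cd$, $ad$ (directed paths of lengths $3$ and $1$ from $a$ to $d$). A graph (digraph) is $H$-free if it contains no (not necessarily induced) subgraph (subdigraph) isomorphic to the graph (digraph) $H$. For a graph (respectively digraph) $H$, $\mathrm{ex}(n,H)$ is the maximum number of edges (respectively arcs) of an $H$-free graph (respectively digraph) on $n$ vertices, and $\mathrm{EX}(n,H)$ is the family of all $H$-free graphs (respectively digraphs) on $n$ vertices attaining this maximum. Families are considered up to isomorphism. For a graph $G$, the double orientation $\overleftrightarrow{G}$ is the digraph obtained from $G$ by replacing every edge $\{u,v\}$ with the two arcs $uv$ and $vu$. *)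

theory Defs
  imports "Graph_Theory.Pair_Digraph" "Graph_Theory.Digraph_Isomorphism"
begin

text \<open>
  Strict digraphs are the \<open>pair_digraph\<close>s of the library: finite, loopless, and with a set of
  ordered pairs as arcs. The library models undirected graphs as symmetric digraphs, which would
  identify a graph with its double orientation; undirected graphs therefore get a type of their
  own, with two-element vertex sets as edges.
\<close>

record 'a ugraph =
  uverts :: "'a set"
  uedges :: "'a set set"

definition simple_graph :: "'a ugraph \<Rightarrow> bool" where
  "simple_graph G \<longleftrightarrow>
     finite (uverts G) \<and> (\<forall>e \<in> uedges G. e \<subseteq> uverts G \<and> card e = 2)"

definition ugraph_subgraph :: "'a ugraph \<Rightarrow> 'a ugraph \<Rightarrow> bool" where
  "ugraph_subgraph S G \<longleftrightarrow>
     simple_graph S \<and> simple_graph G \<and> uverts S \<subseteq> uverts G \<and> uedges S \<subseteq> uedges G"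

definition ugraph_iso :: "'a ugraph \<Rightarrow> 'b ugraph \<Rightarrow> bool" where
  "ugraph_iso G H \<longleftrightarrow>
     (\<exists>f. bij_betw f (uverts G) (uverts H) \<and> uedges H = (`) f ` uedges G)"

definition ugraph_free :: "'b ugraph \<Rightarrow> 'a ugraph \<Rightarrow> bool" where
  "ugraph_free H G \<longleftrightarrow> \<not> (\<exists>S. ugraph_subgraph S G \<and> ugraph_iso H S)"

definition digraph_free :: "'b pair_pre_digraph \<Rightarrow> 'a pair_pre_digraph \<Rightarrow> bool" where
  "digraph_free H G \<longleftrightarrow>
     \<not> (\<exists>S. subgraph S (with_proj G) \<and> digraph_iso (with_proj H) S)"

text \<open>
  Vertices are natural numbers, but the vertex set is an arbitrary \<open>n\<close>-element set, so every
  isomorphism class of (di)graphs on \<open>n\<close> vertices is represented and the families below are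
  closed under isomorphism.
\<close>

definition free_ugraphs :: "nat \<Rightarrow> 'b ugraph \<Rightarrow> nat ugraph set" where
  "free_ugraphs n H = {G. simple_graph G \<and> card (uverts G) = n \<and> ugraph_free H G}"

definition free_digraphs :: "nat \<Rightarrow> 'b pair_pre_digraph \<Rightarrow> nat pair_pre_digraph set" where
  "free_digraphs n H = {G. pair_digraph G \<and> card (pverts G) = n \<and> digraph_free H G}"

definition ex_ugraph :: "nat \<Rightarrow> 'b ugraph \<Rightarrow> nat" where
  "ex_ugraph n H = Max ((\<lambda>G. card (uedges G)) ` free_ugraphs n H)"

definition ex_digraph :: "nat \<Rightarrow> 'b pair_pre_digraph \<Rightarrow> nat" where
  "ex_digraph n H = Max ((\<lambda>G. card (parcs G)) ` free_digraphs n H)"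

definition EX_ugraph :: "nat \<Rightarrow> 'b ugraph \<Rightarrow> nat ugraph set" where
  "EX_ugraph n H = {G \<in> free_ugraphs n H. card (uedges G) = ex_ugraph n H}"

definition EX_digraph :: "nat \<Rightarrow> 'b pair_pre_digraph \<Rightarrow> nat pair_pre_digraph set" where
  "EX_digraph n H = {G \<in> free_digraphs n H. card (parcs G) = ex_digraph n H}"

definition double_orientation :: "'a ugraph \<Rightarrow> 'a pair_pre_digraph" where
  "double_orientation G = \<lparr> pverts = uverts G, parcs = {(u, v). {u, v} \<in> uedges G} \<rparr>"

definition same_up_to_iso :: "'a pair_pre_digraph set \<Rightarrow> 'b pair_pre_digraph set \<Rightarrow> bool" where
  "same_up_to_iso A B \<longleftrightarrow>
     (\<forall>G \<in> A. \<exists>H \<in> B. digraph_iso (with_proj G) (with_proj H)) \<and>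
     (\<forall>H \<in> B. \<exists>G \<in> A. digraph_iso (with_proj G) (with_proj H))"

definition C4 :: "nat ugraph" where
  "C4 = \<lparr> uverts = {0, 1, 2, 3}, uedges = {{0, 1}, {1, 2}, {2, 3}, {3, 0}} \<rparr>"

definition P13 :: "nat pair_pre_digraph" where
  "P13 = \<lparr> pverts = {0, 1, 2, 3}, parcs = {(0, 1), (1, 2), (2, 3), (0, 3)} \<rparr>"

end

theory Submission
  imports Defs
begin

text \<open>
  A symmetric digraph is the double orientation of a graph, and it is free of \<open>P13\<close> iff that graph
  is free of \<open>C4\<close>. Both claims therefore follow once every \<open>P13\<close>-free digraph on \<open>n \<le> 8\<close> vertices
  with at least \<open>2 * e\<close> arcs is symmetric, where \<open>e\<close> is the size of some \<open>C4\<close>-free graph on \<open>n\<close>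
  vertices; the exact value of \<open>ex_ugraph n C4\<close> is not needed. That statement is proved by an
  exhaustive search: deleting a vertex of minimum valency from a dense digraph leaves a dense
  digraph, so all dense \<open>P13\<close>-free digraphs arise by adding one vertex at a time. The arcs
  at a new vertex form an independent set in a conflict graph, because every \<open>P13\<close> through the new
  vertex uses exactly two of them.
\<close>

section \<open>The search\<close>

fun row_degree :: "bool list \<Rightarrow> nat" where
  "row_degree [] = 0"
| "row_degree (x # xs) = (if x then Suc (row_degree xs) else row_degree xs)"

definition weight :: "bool list list \<Rightarrow> nat" where
  "weight M = sum_list (map row_degree M)"

definition columns :: "bool list list \<Rightarrow> bool list list" where
  "columns M = map (\<lambda>k. map (\<lambda>r. r ! k) M) [0..<length M]"

text \<open>An item \<open>(k, a, b)\<close>, where \<open>a\<close> and \<open>b\<close> are the out- and in-row of vertex \<open>k\<close>, stands for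
  the arc from a new vertex to \<open>k\<close>; with the two rows swapped it stands for the reverse arc. In
  this encoding one formula decides for all four choices of directions whether two new arcs, at
  different vertices \<open>k\<close> and \<open>l\<close>, complete a \<open>P13\<close>.\<close>

definition meets :: "bool list \<Rightarrow> bool list \<Rightarrow> bool" where
  "meets a b \<longleftrightarrow> list_ex (\<lambda>(x, y). x \<and> y) (zip a b)"

fun clash :: "nat \<times> bool list \<times> bool list \<Rightarrow> nat \<times> bool list \<times> bool list \<Rightarrow> bool" where
  "clash (k, a, b) (l, c, d) = (if k = l then False else meets a d \<or> meets b c)"

definition items :: "bool list list \<Rightarrow> (nat \<times> bool list \<times> bool list) list" where
  "items M = (let ks = [0..<length M]; N = columns M in zip ks (zip M N) @ zip ks (zip N M))"

fun rows :: "('b \<Rightarrow> 'b \<Rightarrow> bool) \<Rightarrow> 'b list \<Rightarrow> bool list list" where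
  "rows K [] = []"
| "rows K (x # xs) = map (K x) xs # rows K xs"

text \<open>The independent sets, as characteristic lists, that omit at most \<open>s\<close> vertices. The first
  argument is the upper triangle of the adjacency matrix, the second one marks the vertices
  that are already excluded.\<close>

fun indep :: "bool list list \<Rightarrow> bool list \<Rightarrow> nat \<Rightarrow> bool list list" where
  "indep (c # cs) (b # bs) s =
     (if b then [] else map (Cons True) (indep cs (map2 (\<or>) bs c) s)) @
     (case s of 0 \<Rightarrow> [] | Suc t \<Rightarrow> map (Cons False) (indep cs bs t))"
| "indep _ _ _ = [[]]"

text \<open>The first half of \<open>z\<close> is the out-row of the new vertex and the second half
  its in-column, in the order of \<open>items\<close>.\<close>

definition add_vertex :: "bool list list \<Rightarrow> bool list \<Rightarrow> bool list list" where
  "add_vertex M z = (False # take (length M) z) # map2 (#) (drop (length M) z) M"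

text \<open>Vertices are sorted by an isomorphism invariant, so that few matrices remain per isomorphism
  class. Nothing depends on the invariant: every order of the vertices is sound.\<close>

fun masked_sum :: "bool list \<Rightarrow> nat list \<Rightarrow> nat" where
  "masked_sum (x # xs) (k # ks) = (if x then k + masked_sum xs ks else masked_sum xs ks)"
| "masked_sum _ _ = 0"

fun degrees :: "bool list list \<Rightarrow> bool list list \<Rightarrow> nat list" where
  "degrees (a # M) (b # N) = (row_degree a + row_degree b) # degrees M N"
| "degrees _ _ = []"

fun vertex_keys :: "nat list \<Rightarrow> bool list list \<Rightarrow> bool list list \<Rightarrow> nat list" where
  "vertex_keys ds (a # M) (b # N) = (row_degree a + masked_sum a ds + masked_sum b ds) # vertex_keys ds M N"
| "vertex_keys _ _ _ = []"

definition vertex_order :: "bool list list \<Rightarrow> nat list" where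
  "vertex_order M = (let N = columns M in
     sort_key (nth (vertex_keys (degrees M N) M N)) [0..<length M])"

definition pick :: "nat list \<Rightarrow> 'b list \<Rightarrow> 'b list" where
  "pick ps xs = map (nth xs) ps"

definition reorder :: "bool list list \<Rightarrow> bool list list" where
  "reorder M = (let ps = vertex_order M in pick ps (map (pick ps) M))"

text \<open>A new vertex has \<open>2 * length M\<close> possible arcs. For a total of at least
  \<open>t\<close> arcs, at most \<open>2 * length M + weight M - t\<close> of them may be
  missing.\<close>

definition extensions :: "nat \<Rightarrow> bool list list \<Rightarrow> bool list list list" where
  "extensions t M = (let xs = items M in map reorder (map (add_vertex M)
     (indep (rows clash xs) (map (\<lambda>x. False) xs) (2 * length M + weight M - t))))"

section \<open>Generations of matrices without duplicates\<close>

text \<open>A compressed binary trie: \<open>Leaf\<close> keeps the whole remaining list, the left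
  branch of \<open>Fork\<close> belongs to \<open>True\<close>, and \<open>Stop\<close> records a
  list that ends where others continue.\<close>

datatype trie = Empty | Leaf "bool list" | Stop trie | Fork trie trie

fun insert_trie :: "bool list \<Rightarrow> trie \<Rightarrow> trie" where
  "insert_trie xs Empty = Leaf xs"
| "insert_trie [] (Leaf []) = Leaf []"
| "insert_trie [] t = Stop t"
| "insert_trie xs (Stop t) = Stop (insert_trie xs t)"
| "insert_trie (x # xs) (Fork l r) =
     (if x then Fork (insert_trie xs l) r else Fork l (insert_trie xs r))"
| "insert_trie (x # xs) (Leaf []) = Stop (Leaf (x # xs))"
| "insert_trie (x # xs) (Leaf (y # ys)) =
     (if x then if y then Fork (insert_trie xs (Leaf ys)) Empty else Fork (Leaf xs) (Leaf ys)
      else if y then Fork (Leaf ys) (Leaf xs) else Fork Empty (insert_trie xs (Leaf ys)))"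

fun entries :: "trie \<Rightarrow> bool list list" where
  "entries Empty = []"
| "entries (Leaf xs) = [xs]"
| "entries (Stop t) = [] # entries t"
| "entries (Fork l r) = map (Cons True) (entries l) @ map (Cons False) (entries r)"

fun chop :: "nat \<Rightarrow> nat \<Rightarrow> 'b list \<Rightarrow> 'b list list" where
  "chop 0 n zs = []"
| "chop (Suc m) n zs = take n zs # chop m n (drop n zs)"

definition successors :: "nat \<Rightarrow> nat \<Rightarrow> bool list list list \<Rightarrow> bool list list list" where
  "successors n t Ms = map (chop n n)
     (entries (fold insert_trie (map concat (concat (map (extensions t) Ms))) Empty))"

text \<open>Conditionals instead of connectives keep the evaluation lazy.\<close>

definition light_or_symmetric :: "nat \<Rightarrow> bool list list \<Rightarrow> bool" where
  "light_or_symmetric e M = (if weight M < e then True else M = columns M)"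

text \<open>The first inequality is the averaging bound: with at least \<open>t\<close> arcs on
  \<open>n + 1\<close> vertices, deleting a vertex of at most average valency leaves at least
  \<open>s\<close> arcs. By \<open>t \<le> e\<close>, the new list reaches all digraphs with at
  least \<open>e\<close> arcs.\<close>

fun check :: "nat \<Rightarrow> nat \<Rightarrow> bool list list list \<Rightarrow> (nat \<times> nat) list \<Rightarrow> bool" where
  "check n s Ms [] = True"
| "check n s Ms ((t, e) # ts) =
     (if Suc n * s < (n - 1) * t + Suc n \<and> t \<le> e then
        (let Ns = successors (Suc n) t Ms
         in if list_all (light_or_symmetric e) Ns then check (Suc n) t Ns ts else False)
      else False)"

section \<open>Completeness of the search\<close>

definition P13_free_on :: "'a set \<Rightarrow> ('a \<Rightarrow> 'a \<Rightarrow> bool) \<Rightarrow> bool" where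
  "P13_free_on V R \<longleftrightarrow> (\<forall>a\<in>V. \<forall>b\<in>V. \<forall>c\<in>V. \<forall>d\<in>V.
     distinct [a, b, c, d] \<longrightarrow> R a b \<longrightarrow> R b c \<longrightarrow> R c d \<longrightarrow> \<not> R a d)"

definition arc_count :: "'a set \<Rightarrow> ('a \<Rightarrow> 'a \<Rightarrow> bool) \<Rightarrow> nat" where
  "arc_count V R = (\<Sum>u\<in>V. \<Sum>v\<in>V. of_bool (R u v))"

definition valency :: "'a set \<Rightarrow> ('a \<Rightarrow> 'a \<Rightarrow> bool) \<Rightarrow> 'a \<Rightarrow> nat" where
  "valency V R v = (\<Sum>u\<in>V. of_bool (R v u)) + (\<Sum>u\<in>V. of_bool (R u v))"

definition adjacency :: "('a \<Rightarrow> 'a \<Rightarrow> bool) \<Rightarrow> 'a list \<Rightarrow> bool list list" where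
  "adjacency R vs = map (\<lambda>u. map (R u) vs) vs"

lemma row_degree_map:
  "distinct vs \<Longrightarrow> row_degree (map P vs) = (\<Sum>v\<in>set vs. of_bool (P v))"
  by (induction vs) auto

lemma row_degree_append: "row_degree (xs @ ys) = row_degree xs + row_degree ys"
  by (induction xs) auto

lemma row_degree_filter: "row_degree (map S xs) + length (filter (\<lambda>x. \<not> S x) xs) = length xs"
  by (induction xs) auto

lemma weight_adjacency:
  assumes "distinct vs" shows "weight (adjacency R vs) = arc_count (set vs) R"
  using assms by (simp add: weight_def adjacency_def arc_count_def comp_def row_degree_map
      sum_list_distinct_conv_sum_set)

lemma columns_adjacency: "columns (adjacency R vs) = map (\<lambda>u. map (\<lambda>v. R v u) vs) vs"
  by (rule nth_equalityI) (simp_all add: columns_def adjacency_def)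

lemma meets_map: "meets (map P vs) (map Q vs) \<longleftrightarrow> (\<exists>v\<in>set vs. P v \<and> Q v)"
  by (auto simp: meets_def list_ex_iff zip_map_map zip_same_conv_map)

lemma rows_map: "rows K (map f xs) = rows (\<lambda>x y. K (f x) (f y)) xs"
  by (induction xs) auto

text \<open>Follow the branch that \<open>S\<close> prescribes: choosing \<open>x\<close> marks its
  later neighbours as excluded, omitting \<open>x\<close> uses up one unit of
  \<open>s\<close>.\<close>

lemma indep_complete:
  assumes "sorted_wrt (\<lambda>x y. K x y \<longrightarrow> \<not> (S x \<and> S y)) xs"
    and "\<forall>x\<in>set xs. b x \<longrightarrow> \<not> S x"
    and "length (filter (\<lambda>x. \<not> S x) xs) \<le> s"
  shows "map S xs \<in> set (indep (rows K xs) (map b xs) s)"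
  using assms
proof (induction xs arbitrary: b s)
  case (Cons x xs)
  show ?case
  proof (cases "S x")
    case True
    have "map S xs \<in> set (indep (rows K xs) (map (\<lambda>y. b y \<or> K x y) xs) s)"
      using Cons.prems True by (intro Cons.IH) auto
    moreover have "map2 (\<or>) (map b xs) (map (K x) xs) = map (\<lambda>y. b y \<or> K x y) xs"
      by (simp add: zip_map_map zip_same_conv_map)
    ultimately show ?thesis
      using True Cons.prems by auto
  next
    case False
    then obtain t where s: "s = Suc t"
      using Cons.prems by (cases s) auto
    have "map S xs \<in> set (indep (rows K xs) (map b xs) t)"
      using Cons.prems False s by (intro Cons.IH) auto
    then show ?thesis
      using False s by simp
  qed
qed simp

lemma add_vertex_adjacency:
  assumes "\<not> R v v"
  shows "adjacency R (v # vs)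
    = add_vertex (adjacency R vs) (map (R v) vs @ map (\<lambda>u. R u v) vs)"
  using assms by (simp add: adjacency_def add_vertex_def zip_map_map zip_same_conv_map comp_def)

lemma pick_adjacency:
  assumes "set ps \<subseteq> {..<length vs}"
  shows "adjacency R (pick ps vs) = pick ps (map (pick ps) (adjacency R vs))"
  using assms by (auto simp: adjacency_def pick_def comp_def subset_iff)

text \<open>Sorting the indices permutes them, whatever the keys are, so the result is a matrix of
  the same relation for another order of the vertices.\<close>

lemma reorder_adjacency:
  assumes "distinct vs"
  obtains us where "distinct us" "set us = set vs" "reorder (adjacency R vs) = adjacency R us"
proof -
  define ps where "ps = vertex_order (adjacency R vs)"
  have ps: "set ps = {..<length vs}" "distinct ps"
    by (auto simp: ps_def vertex_order_def adjacency_def Let_def)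
  have "set (pick ps vs) = set vs"
    unfolding pick_def set_map ps(1) by (auto simp: set_conv_nth)
  moreover have "distinct (pick ps vs)"
    using ps assms by (auto simp: pick_def distinct_map inj_on_def nth_eq_iff_index_eq)
  ultimately show ?thesis
    using that[of "pick ps vs"] ps(1) pick_adjacency[of ps vs R]
    by (simp add: reorder_def Let_def flip: ps_def)
qed

section \<open>Extension by one vertex\<close>

lemma extensions_complete:
  assumes free: "P13_free_on (insert v (set vs)) R"
    and irrefl: "\<forall>u\<in>insert v (set vs). \<not> R u u"
    and dist: "distinct (v # vs)"
    and arcs: "t \<le> arc_count (set vs) R + valency (set vs) R v"
  obtains us where "distinct us" "set us = insert v (set vs)"
    "adjacency R us \<in> set (extensions t (adjacency R vs))"
proof -
  define n where "n = length vs"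
  define M where "M = adjacency R vs"
  \<comment> \<open>The pair \<open>(k, True)\<close> names the arc from \<open>v\<close> to
    \<open>vs ! k\<close>, and \<open>(k, False)\<close> the reverse arc. \<open>f\<close> gives its
    item, and \<open>S\<close> tells whether the arc is present.\<close>
  define idx where "idx = map (\<lambda>k. (k, True)) [0..<n] @ map (\<lambda>k. (k, False)) [0..<n]"
  define out where "out k = map (R (vs ! k)) vs" for k
  define inn where "inn k = map (\<lambda>u. R u (vs ! k)) vs" for k
  define f where "f = (\<lambda>(k, d). (k, if d then (out k, inn k) else (inn k, out k)))"
  define S where "S = (\<lambda>(k, d). if d then R v (vs ! k) else R (vs ! k) v)"
  have M: "M = map out [0..<n]" and N: "columns M = map inn [0..<n]"
    unfolding M_def columns_adjacency
    by (auto simp: adjacency_def out_def inn_def n_def intro!: nth_equalityI)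
  have items: "items M = map f idx"
    unfolding items_def Let_def N unfolding M
    by (auto simp: idx_def f_def intro!: nth_equalityI)
  have S: "map S idx = map (R v) vs @ map (\<lambda>u. R u v) vs"
    by (auto simp: idx_def S_def n_def intro!: nth_equalityI)
  have clash: "\<not> (S x \<and> S y)" if xy: "x \<in> set idx" "y \<in> set idx" "clash (f x) (f y)" for x y
  proof -
    obtain k d l d' where [simp]: "x = (k, d)" "y = (l, d')" by (cases x, cases y) auto
    have kl: "k < n" "l < n" "k \<noteq> l"
      using xy by (auto simp: idx_def f_def split: if_splits)
    define p q where "p = vs ! k" and "q = vs ! l"
    have pq: "p \<in> set vs" "q \<in> set vs" "p \<noteq> q" "p \<noteq> v" "q \<noteq> v"
      using kl dist by (auto simp: p_def q_def n_def nth_eq_iff_index_eq)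
    have no: "\<not> (R a b \<and> R b c \<and> R c d \<and> R a d)"
      if "{a, b, c, d} \<subseteq> insert v (set vs)" "distinct [a, b, c, d]" for a b c d
      using free that unfolding P13_free_on_def by blast
    \<comment> \<open>A clash provides a vertex \<open>w\<close> whose arcs with \<open>p\<close>
      and \<open>q\<close> close the two new arcs to a four-cycle oriented as
      \<open>P13\<close>.\<close>
    have common: "\<exists>w\<in>set vs. (if d then R p w else R w p) \<and> (if d' then R w q else R q w)
        \<or> (if d then R w p else R p w) \<and> (if d' then R q w else R w q)"
      using xy(3) kl(3)
      by (cases d; cases d') (auto simp: f_def out_def inn_def meets_map p_def q_def)
    then obtain w where w: "w \<in> set vs" "(if d then R p w else R w p) \<and> (if d' then R w q else R q w)
        \<or> (if d then R w p else R p w) \<and> (if d' then R q w else R w q)" by blast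
    have wpq: "w \<noteq> p" "w \<noteq> q" "w \<noteq> v"
      using w irrefl pq dist by (auto split: if_splits)
    have SS: "S x = (if d then R v p else R p v)" "S y = (if d' then R v q else R q v)"
      by (auto simp: S_def p_def q_def)
    show ?thesis
    proof
      assume "S x \<and> S y"
      then have s: "if d then R v p else R p v" "if d' then R v q else R q v"
        using SS by auto
      \<comment> \<open>Four choices of directions for the new arcs, and for each of them the two
        disjuncts of \<open>common\<close>.\<close>
      have "\<not> (R v p \<and> R p w \<and> R w q \<and> R v q)"
        "\<not> (R v q \<and> R q w \<and> R w p \<and> R v p)"
        "\<not> (R q v \<and> R v p \<and> R p w \<and> R q w)"
        "\<not> (R w q \<and> R q v \<and> R v p \<and> R w p)"
        "\<not> (R w p \<and> R p v \<and> R v q \<and> R w q)"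
        "\<not> (R p v \<and> R v q \<and> R q w \<and> R p w)"
        "\<not> (R q w \<and> R w p \<and> R p v \<and> R q v)"
        "\<not> (R p w \<and> R w q \<and> R q v \<and> R p v)"
        by (rule no; use pq w(1) wpq in simp)+
      then show False
        using w(2) s by (cases d; cases d'; simp only: if_True if_False; blast)
    qed
  qed
  have "map S idx \<in> set (indep (rows (\<lambda>x y. clash (f x) (f y)) idx) (map (\<lambda>x. False) idx)
      (2 * length M + weight M - t))"
  proof (rule indep_complete)
    show "sorted_wrt (\<lambda>x y. clash (f x) (f y) \<longrightarrow> \<not> (S x \<and> S y)) idx"
      unfolding sorted_wrt_iff_nth_less using clash by (meson nth_mem order.strict_trans)
    have "row_degree (map S idx) = valency (set vs) R v"
      using dist by (simp add: S row_degree_append row_degree_map valency_def)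
    moreover have "length idx = 2 * length M"
      by (simp add: idx_def M)
    moreover have "weight M = arc_count (set vs) R"
      using dist by (simp add: M_def weight_adjacency)
    ultimately show "length (filter (\<lambda>x. \<not> S x) idx) \<le> 2 * length M + weight M - t"
      using arcs row_degree_filter[of S idx] by linarith
  qed simp
  then have "map S idx \<in> set (indep (rows clash (items M)) (map (\<lambda>x. False) (items M))
      (2 * length M + weight M - t))"
    by (simp add: items rows_map comp_def)
  moreover have "adjacency R (v # vs) = add_vertex M (map S idx)"
    using irrefl unfolding S M_def by (intro add_vertex_adjacency) simp
  ultimately have "reorder (adjacency R (v # vs)) \<in> set (extensions t M)"
    by (simp add: extensions_def Let_def)
  then show ?thesis
    using reorder_adjacency[OF dist, of R] that unfolding M_def by (metis list.simps(15))
qed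

lemma entries_insert_trie: "insert xs (set (entries t)) \<subseteq> set (entries (insert_trie xs t))"
  by (induction xs t rule: insert_trie.induct) auto

lemma entries_fold_insert_trie:
  "set xss \<union> set (entries t) \<subseteq> set (entries (fold insert_trie xss t))"
proof (induction xss arbitrary: t)
  case (Cons xs xss)
  then show ?case
    using entries_insert_trie[of xs t] Cons[of "insert_trie xs t"] by auto
qed simp

lemma chop_concat: "\<forall>r\<in>set M. length r = n \<Longrightarrow> chop (length M) n (concat M) = M"
  by (induction M) auto

lemma successors_complete:
  assumes "M \<in> set Ms" "adjacency R vs \<in> set (extensions t M)"
  shows "adjacency R vs \<in> set (successors (length vs) t Ms)"
proof -
  have "concat (adjacency R vs) \<in> set (map concat (concat (map (extensions t) Ms)))"
    using assms by auto
  then have "concat (adjacency R vs) \<in>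
      set (entries (fold insert_trie (map concat (concat (map (extensions t) Ms))) Empty))"
    using entries_fold_insert_trie by blast
  moreover have "chop (length vs) (length vs) (concat (adjacency R vs)) = adjacency R vs"
    using chop_concat[of "adjacency R vs" "length vs"] by (simp add: adjacency_def)
  ultimately show ?thesis
    unfolding successors_def by (metis image_eqI list.set_map)
qed

section \<open>Averaging and vertex deletion\<close>

lemma sum_valency: "(\<Sum>v\<in>V. valency V R v) = 2 * arc_count V R"
proof -
  have "(\<Sum>v\<in>V. \<Sum>u\<in>V. of_bool (R u v)) = arc_count V R"
    unfolding arc_count_def by (rule sum.swap)
  then show ?thesis
    by (simp add: valency_def sum.distrib arc_count_def)
qed

lemma small_valency:
  assumes "finite V" "V \<noteq> {}"
  obtains v where "v \<in> V" "card V * valency V R v \<le> 2 * arc_count V R"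
proof (rule ccontr)
  assume "\<not> thesis"
  then have "\<forall>v\<in>V. 2 * arc_count V R < card V * valency V R v"
    using that by force
  then have "(\<Sum>v\<in>V. 2 * arc_count V R) < (\<Sum>v\<in>V. card V * valency V R v)"
    using assms by (intro sum_strict_mono) auto
  then show False
    by (simp add: sum_valency flip: sum_distrib_left)
qed

lemma arc_count_insert:
  assumes "finite V" "v \<notin> V" "\<not> R v v"
  shows "arc_count (insert v V) R = arc_count V R + valency V R v"
    and "valency (insert v V) R v = valency V R v"
  using assms by (simp_all add: arc_count_def valency_def sum.distrib del: sum_of_bool_eq)

text \<open>The invariant of the search. One order of the vertices suffices, so the list is complete
  up to isomorphism; quantifying over all vertex sets avoids relabelling after a deletion.\<close>

definition covers :: "nat \<Rightarrow> nat \<Rightarrow> bool list list list \<Rightarrow> bool" where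
  "covers n t Ms \<longleftrightarrow> (\<forall>(V :: nat set) R. finite V \<longrightarrow> card V = n \<longrightarrow> (\<forall>v\<in>V. \<not> R v v) \<longrightarrow>
     P13_free_on V R \<longrightarrow> t \<le> arc_count V R \<longrightarrow>
     (\<exists>vs. distinct vs \<and> set vs = V \<and> adjacency R vs \<in> set Ms))"

lemma covers_successors:
  assumes n: "0 < n" and cov: "covers n s Ms" and ts: "Suc n * s < (n - 1) * t + Suc n"
  shows "covers (Suc n) t (successors (Suc n) t Ms)"
  unfolding covers_def
proof (intro allI impI)
  fix V :: "nat set" and R
  assume V: "finite V" "card V = Suc n" "\<forall>v\<in>V. \<not> R v v" "P13_free_on V R" "t \<le> arc_count V R"
  obtain v where v: "v \<in> V" "card V * valency V R v \<le> 2 * arc_count V R"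
    using small_valency V by (metis card.empty nat.distinct(1))
  define W where "W = V - {v}"
  have W: "V = insert v W" "v \<notin> W" "finite W" "card W = n"
    using V v by (auto simp: W_def)
  note count = arc_count_insert[of W v R]
  have free: "P13_free_on W R"
    using V(4) unfolding W(1) P13_free_on_def by blast
  have "s \<le> arc_count W R"
  proof (rule ccontr)
    \<comment> \<open>Otherwise \<open>m + 1 \<le> s + d\<close>, and with \<open>N = n + 1\<close>
      one gets \<open>N * (m + 1) \<le> N * s + 2 * m < (n - 1) * t + N + 2 * m \<le> N * (m +
      1)\<close>.\<close>
    define m where "m = arc_count V R"
    define d where "d = valency W R v"
    assume "\<not> s \<le> arc_count W R"
    then have "m < s + d" 
      using count W V(3) by (simp add: m_def d_def)
    moreover have "Suc n * d \<le> 2 * m" "t \<le> m"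
      using v V count W by (simp_all add: m_def d_def)
    ultimately have "int (Suc n) * (int m + 1) \<le> int (Suc n) * (int s + int d)"
      by (intro mult_left_mono) auto
    moreover have "int (Suc n) * int d \<le> 2 * int m"
      using \<open>Suc n * d \<le> 2 * m\<close> by (metis of_nat_le_iff of_nat_mult of_nat_numeral)
    moreover have "int (Suc n) * int s < (int n - 1) * int t + int (Suc n)"
      using ts n by (metis (mono_tags) of_nat_1 of_nat_add of_nat_diff of_nat_less_iff of_nat_mult Suc_leI One_nat_def)
    moreover have "(int n - 1) * int t \<le> (int n - 1) * int m"
      using \<open>t \<le> m\<close> n by (intro mult_left_mono) auto
    ultimately show False by (simp add: algebra_simps)
  qed
  then obtain vs where vs: "distinct vs" "set vs = W" "adjacency R vs \<in> set Ms"
    using cov free W V(3) unfolding covers_def by blast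
  obtain us where us: "distinct us" "set us = insert v (set vs)"
    "adjacency R us \<in> set (extensions t (adjacency R vs))"
  proof (rule extensions_complete)
    show "t \<le> arc_count (set vs) R + valency (set vs) R v"
      using V W vs count by simp
  qed (use V W vs in auto)
  have "length us = Suc n"
    using us vs W by (metis V(2) distinct_card)
  then show "\<exists>vs. distinct vs \<and> set vs = V \<and> adjacency R vs \<in> set (successors (Suc n) t Ms)"
    using us vs W successors_complete[OF vs(3) us(3)] by auto
qed

lemma light_or_symmetric_adjacency:
  assumes "distinct vs" "light_or_symmetric e (adjacency R vs)" "e \<le> arc_count (set vs) R"
    and "u \<in> set vs" "v \<in> set vs" "R u v"
  shows "R v u"
proof -
  have "adjacency R vs = columns (adjacency R vs)"
    using assms by (auto simp: light_or_symmetric_def weight_adjacency split: if_splits)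
  then show ?thesis
    using assms(4-) unfolding columns_adjacency by (auto simp: adjacency_def)
qed

section \<open>Symmetry of dense digraphs\<close>

text \<open>Induction along the list, with \<open>covers_successors\<close> maintaining the
  invariant. Entry \<open>i\<close> concerns \<open>n + i + 1\<close> vertices.\<close>

lemma check_symmetric:
  assumes "0 < n" "covers n s Ms" "check n s Ms ts" "i < length ts"
    and V: "finite V" "card V = Suc (n + i)" "\<forall>v\<in>V. \<not> R v v" "P13_free_on V R"
      "snd (ts ! i) \<le> arc_count V R"
    and uv: "u \<in> V" "v \<in> V" "R u v"
  shows "R v (u :: nat)"
  using assms
proof (induction n s Ms ts arbitrary: i rule: check.induct)
  case (2 n s Ms t e ts)
  define Ns where "Ns = successors (Suc n) t Ms"
  have step: "Suc n * s < (n - 1) * t + Suc n" "t \<le> e" "list_all (light_or_symmetric e) Ns"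
    "check (Suc n) t Ns ts"
    using 2(4) by (simp_all add: Ns_def Let_def split: if_splits)
  have cov: "covers (Suc n) t Ns"
    unfolding Ns_def using 2(2,3) step(1) by (rule covers_successors)
  show ?case
  proof (cases i)
    case 0
    have "card V = Suc n" "t \<le> arc_count V R"
      using 2(7,10) step(2) 0 by simp_all
    then obtain vs where vs: "distinct vs" "set vs = V" "adjacency R vs \<in> set Ns"
      using cov 2(6,8,9) unfolding covers_def by blast
    then show ?thesis
      using light_or_symmetric_adjacency[of vs e R u v] step(3) 2(10-) 0 by (auto simp: list_all_iff)
  next
    case (Suc j)
    show ?thesis
    proof (rule "2.IH"[OF _ Ns_def _ _ cov step(4)])
      show "j < length ts" "card V = Suc (Suc n + j)" "snd (ts ! j) \<le> arc_count V R"
        using 2(5,7,10) Suc by simp_all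
    qed (use 2(6,8,9,11-13) step(1-3) in simp_all)
  qed
qed simp

lemma covers_1: "covers 1 0 [[[False]]]"
  unfolding covers_def
proof (intro allI impI)
  fix V :: "nat set" and R
  assume "card V = 1" and irrefl: "\<forall>v\<in>V. \<not> R v v"
  then obtain v where "V = {v}"
    by (auto simp: card_1_singleton_iff)
  then show "\<exists>vs. distinct vs \<and> set vs = V \<and> adjacency R vs \<in> set [[[False]]]"
    using irrefl by (intro exI[of _ "[v]"]) (simp add: adjacency_def)
qed

text \<open>The vertices below \<open>n\<close> induce an extremal \<open>C4\<close>-free graph for every \<open>n \<le> 8\<close>.\<close>

definition extremal_edges :: "(nat \<times> nat) list" where
  "extremal_edges = [(0, 1), (0, 2), (1, 2), (0, 3), (0, 4), (3, 4), (1, 5), (1, 6), (5, 6), (3, 7), (5, 7)]"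

definition extremal_size :: "nat \<Rightarrow> nat" where
  "extremal_size n = length (filter (\<lambda>(u, v). v < n) extremal_edges)"

text \<open>The pairs \<open>(t, e)\<close> for 2 to 8 vertices. A digraph with \<open>n\<close> vertices and at least \<open>t\<close> arcs
  has a vertex of valency at most the average, whose deletion leaves at least the previous
  \<open>t\<close> arcs; \<open>e\<close> is \<open>2 * extremal_size n\<close>.\<close>

definition thresholds :: "(nat \<times> nat) list" where
  "thresholds = [(1, 2), (3, 6), (6, 8), (9, 12), (13, 14), (17, 18), (22, 22)]"

text \<open>The whole search is evaluated here. Counting back from 22, each first component is the
  largest that passes the averaging test of \<open>check\<close>.\<close>

lemma check_thresholds: "check 1 0 [[[False]]] thresholds"
  by code_simp

lemma dense_symmetric:
  assumes n: "1 \<le> n" "n \<le> 8"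
    and V: "finite V" "card V = n" "\<forall>v\<in>V. \<not> R v v" "P13_free_on V R"
      "2 * extremal_size n \<le> arc_count V R"
    and uv: "u \<in> V" "v \<in> V" "R u v"
  shows "R v (u :: nat)"
proof (cases "n = 1")
  case True
  then show ?thesis
    using V(2) uv by (auto simp: card_1_singleton_iff)
next
  case False
  have "check 1 0 [[[False]]] thresholds"
    by (rule check_thresholds)
  \<comment> \<open>The list of thresholds starts at two vertices.\<close>
  moreover have "n - 2 < length thresholds"
    using n False by (simp add: thresholds_def)
  moreover have "snd (thresholds ! (n - 2)) = 2 * extremal_size n"
  proof -
    have "n \<in> {2, 3, 4, 5, 6, 7, 8}" using n False by auto
    then show ?thesis
      by (auto simp: thresholds_def extremal_size_def extremal_edges_def)
  qed
  ultimately show ?thesis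
    using check_symmetric[OF _ covers_1, of thresholds "n - 2" V R u v] n False V uv by simp
qed

section \<open>Graphs and digraphs\<close>

lemma digraph_free_P13D:
  assumes G: "pair_digraph G" and free: "digraph_free P13 G"
  shows "P13_free_on (pverts G) (\<lambda>u v. (u, v) \<in> parcs G)"
  unfolding P13_free_on_def
proof (intro ballI impI notI)
  fix a b c d
  assume V: "a \<in> pverts G" "b \<in> pverts G" "c \<in> pverts G" "d \<in> pverts G"
    and dist: "distinct [a, b, c, d]"
    and E: "(a, b) \<in> parcs G" "(b, c) \<in> parcs G" "(c, d) \<in> parcs G" "(a, d) \<in> parcs G"
  \<comment> \<open>The default value \<open>d\<close> is the image of 3.\<close>
  define f :: "nat \<Rightarrow> _" where "f = (\<lambda>_. d)(0 := a, 1 := b, 2 := c)"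
  define hom where "hom = \<lparr>iso_verts = f, iso_arcs = map_prod f f, iso_head = snd, iso_tail = fst\<rparr>"
  define S where "S = with_proj \<lparr>pverts = {a, b, c, d}, parcs = {(a, b), (b, c), (c, d), (a, d)}\<rparr>"
  have "subgraph S (with_proj G)"
    using V E G unfolding subgraph_def S_def
    by (auto simp: compatible_def with_proj_def wf_digraph_def pair_digraph_def
        dest: pair_fin_digraph.axioms(1) pair_wf_digraph.in_arcsD1 pair_wf_digraph.in_arcsD2)
  moreover have "app_iso hom (with_proj P13) = S"
    by (auto simp: app_iso_def hom_def S_def P13_def f_def with_proj_def)
  moreover have "pre_digraph.digraph_isomorphism (with_proj P13) hom"
    using dist by (auto simp: pre_digraph.digraph_isomorphism_def wf_digraph_def hom_def P13_def f_def)
  ultimately show False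
    using free unfolding digraph_free_def digraph_iso_def by blast
qed

lemma digraph_free_P13I:
  assumes free: "P13_free_on (pverts G) (\<lambda>u v. (u, v) \<in> parcs G)"
  shows "digraph_free P13 G"
  unfolding digraph_free_def
proof (rule notI, elim exE conjE)
  fix S assume S: "subgraph S (with_proj G)" and "digraph_iso (with_proj P13) S"
  then obtain hom where hom: "pre_digraph.digraph_isomorphism (with_proj P13) hom"
    and S_hom: "S = app_iso hom (with_proj P13)"
    unfolding digraph_iso_def by blast
  define f where "f = iso_verts hom"
  have inj: "inj_on f {0, 1, 2, 3}"
    using pre_digraph.digraph_isomorphism_inj_on_verts[OF hom] by (simp add: f_def P13_def)
  have V: "f x \<in> pverts G" if "x \<in> {0, 1, 2, 3}" for x
    using S that by (auto simp: subgraph_def S_hom f_def P13_def)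
  \<comment> \<open>A subgraph of \<open>with_proj G\<close> has \<open>fst\<close> and
    \<open>snd\<close> as its tail and head maps, so the image of an arc is the pair of the images
    of its ends.\<close>
  have E: "(f x, f y) \<in> parcs G" if "(x, y) \<in> parcs P13" for x y
  proof -
    have "iso_arcs hom (x, y) \<in> parcs G" "iso_tail hom = fst" "iso_head hom = snd"
      using S that by (auto simp: subgraph_def S_hom compatible_def)
    moreover have "f x = iso_tail hom (iso_arcs hom (x, y))" "f y = iso_head hom (iso_arcs hom (x, y))"
      using hom that by (auto simp: pre_digraph.digraph_isomorphism_def f_def)
    ultimately show ?thesis by simp
  qed
  have "distinct [f 0, f 1, f 2, f 3]"
    using inj by (auto simp: inj_on_def)
  moreover have "(f 0, f 1) \<in> parcs G" "(f 1, f 2) \<in> parcs G" "(f 2, f 3) \<in> parcs G" "(f 0, f 3) \<in> parcs G"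
    by (intro E; simp add: P13_def)+
  ultimately show False
    using free V[of 0] V[of 1] V[of 2] V[of 3] unfolding P13_free_on_def by blast
qed

text \<open>For a symmetric relation the arc from \<open>a\<close> to \<open>d\<close> is also the
  edge that closes the path \<open>a\<close>, \<open>b\<close>, \<open>c\<close>, \<open>d\<close>
  to a four-cycle.\<close>

lemma ugraph_free_C4_iff:
  assumes G: "simple_graph G"
  shows "ugraph_free C4 G \<longleftrightarrow>
    P13_free_on (uverts G) (\<lambda>u v. {u, v} \<in> uedges G)"
proof
  assume free: "ugraph_free C4 G"
  show "P13_free_on (uverts G) (\<lambda>u v. {u, v} \<in> uedges G)"
    unfolding P13_free_on_def
  proof (intro ballI impI notI)
    fix a b c d
    assume V: "a \<in> uverts G" "b \<in> uverts G" "c \<in> uverts G" "d \<in> uverts G"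
      and dist: "distinct [a, b, c, d]"
      and E: "{a, b} \<in> uedges G" "{b, c} \<in> uedges G" "{c, d} \<in> uedges G" "{a, d} \<in> uedges G"
    define f :: "nat \<Rightarrow> _" where "f = (\<lambda>_. d)(0 := a, 1 := b, 2 := c)"
    define S where "S = \<lparr>uverts = {a, b, c, d}, uedges = {{a, b}, {b, c}, {c, d}, {d, a}}\<rparr>"
    have "ugraph_subgraph S G"
      using V E G dist by (auto simp: ugraph_subgraph_def simple_graph_def S_def insert_commute)
    moreover have "ugraph_iso C4 S"
      unfolding ugraph_iso_def using dist
      by (intro exI[of _ f]) (auto simp: bij_betw_def C4_def S_def f_def)
    ultimately show False
      using free unfolding ugraph_free_def by blast
  qed
next
  assume free: "P13_free_on (uverts G) (\<lambda>u v. {u, v} \<in> uedges G)"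
  show "ugraph_free C4 G"
    unfolding ugraph_free_def
  proof (rule notI, elim exE conjE)
    fix S assume S: "ugraph_subgraph S G" and "ugraph_iso C4 S"
    then obtain f where f: "bij_betw f (uverts C4) (uverts S)" "uedges S = (`) f ` uedges C4"
      unfolding ugraph_iso_def by blast
    have inj: "inj_on f {0, 1, 2, 3}" and V: "f ` {0, 1, 2, 3} \<subseteq> uverts G"
      using f(1) S by (auto simp: bij_betw_def C4_def ugraph_subgraph_def)
    have E: "{{f 0, f 1}, {f 1, f 2}, {f 2, f 3}, {f 3, f 0}} \<subseteq> uedges G"
      using f(2) S by (simp add: C4_def ugraph_subgraph_def)
    have "distinct [f 0, f 1, f 2, f 3]"
      using inj by (auto simp: inj_on_def)
    moreover have "{f 0, f 1} \<in> uedges G" "{f 1, f 2} \<in> uedges G" "{f 2, f 3} \<in> uedges G"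
      "{f 0, f 3} \<in> uedges G"
      using E by (auto simp: insert_commute)
    ultimately show False
      using free V unfolding P13_free_on_def by blast
  qed
qed

section \<open>Arc counts and double orientations\<close>

lemma arc_count_parcs:
  assumes "pair_digraph G"
  shows "arc_count (pverts G) (\<lambda>u v. (u, v) \<in> parcs G) = card (parcs G)"
proof -
  interpret pair_digraph G by fact
  have "card (parcs G) = card (Sigma (pverts G) (\<lambda>u. {v \<in> pverts G. (u, v) \<in> parcs G}))"
    by (rule arg_cong[where f = card]) (auto dest: in_arcsD1 in_arcsD2)
  also have "\<dots> = (\<Sum>u\<in>pverts G. card {v \<in> pverts G. (u, v) \<in> parcs G})"
    using finite_verts by (intro card_SigmaI) auto
  finally show ?thesis
    using finite_verts by (simp add: arc_count_def Int_def)
qed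

lemma simple_graph_edgeD:
  assumes "simple_graph G" "{u, v} \<in> uedges G"
  shows "u \<in> uverts G" "v \<in> uverts G" "u \<noteq> v"
proof -
  have "{u, v} \<subseteq> uverts G" "card {u, v} = 2"
    using assms by (auto simp: simple_graph_def)
  then show "u \<in> uverts G" "v \<in> uverts G" "u \<noteq> v"
    by auto
qed

lemma finite_uedges: "simple_graph G \<Longrightarrow> finite (uedges G)"
  by (rule finite_subset[of _ "Pow (uverts G)"]) (auto simp: simple_graph_def)

lemma double_orientation_free:
  assumes "G \<in> free_ugraphs n C4"
  shows "double_orientation G \<in> free_digraphs n P13"
proof -
  have G: "simple_graph G" "card (uverts G) = n" "P13_free_on (uverts G) (\<lambda>u v. {u, v} \<in> uedges G)"
    using assms ugraph_free_C4_iff by (auto simp: free_ugraphs_def)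
  have fin: "finite (uverts G)" and sub: "parcs (double_orientation G) \<subseteq> uverts G \<times> uverts G"
    using G(1) by (auto simp: simple_graph_def double_orientation_def)
  have "pair_digraph (double_orientation G)"
    using simple_graph_edgeD[OF G(1)] fin finite_subset[OF sub]
    by unfold_locales (auto simp: double_orientation_def)
  moreover have "digraph_free P13 (double_orientation G)"
    using G(3) by (intro digraph_free_P13I) (simp add: double_orientation_def)
  ultimately show ?thesis
    using G(2) by (simp add: free_digraphs_def double_orientation_def)
qed

lemma card_double_orientation:
  assumes G: "simple_graph G"
  shows "card (parcs (double_orientation G)) = 2 * card (uedges G)"
proof -
  \<comment> \<open>Group the arcs by their underlying edge; every edge carries exactly two.\<close>
  have "parcs (double_orientation G) = (\<Union>e\<in>uedges G. {(u, v). {u, v} = e})"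
    by (auto simp: double_orientation_def)
  also have "card \<dots> = (\<Sum>e\<in>uedges G. card {(u, v). {u, v} = e})"
  proof (rule card_UN_disjoint)
    show "finite (uedges G)" using G by (rule finite_uedges)
    show "\<forall>e\<in>uedges G. finite {(u, v). {u, v} = e}"
    proof
      fix e assume "e \<in> uedges G"
      then have "finite e"
        using G by (intro card_ge_0_finite) (simp add: simple_graph_def)
      moreover have "{(u, v). {u, v} = e} \<subseteq> e \<times> e" by auto
      ultimately show "finite {(u, v). {u, v} = e}"
        by (meson finite_SigmaI finite_subset)
    qed
  qed auto
  also have "\<dots> = (\<Sum>e\<in>uedges G. 2)"
  proof (rule sum.cong)
    fix e assume "e \<in> uedges G"
    then obtain a b where ab: "e = {a, b}" "a \<noteq> b"
      using G by (metis card_2_iff simple_graph_def)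
    then have "{(u, v). {u, v} = e} = {(a, b), (b, a)}"
      by (auto simp: doubleton_eq_iff)
    then show "card {(u, v). {u, v} = e} = 2"
      using ab by simp
  qed simp
  finally show ?thesis by simp
qed

text \<open>By \<open>dense_symmetric\<close> the arcs come in opposite pairs, so \<open>D\<close>
  equals, and is not merely isomorphic to, the double orientation of its underlying graph.\<close>

lemma dense_digraph_double_orientation:
  assumes n: "1 \<le> n" "n \<le> 8" and D: "D \<in> free_digraphs n P13"
    and dense: "2 * extremal_size n \<le> card (parcs D)"
  obtains G where "G \<in> free_ugraphs n C4" "D = double_orientation G"
proof -
  have pd: "pair_digraph D" and card: "card (pverts D) = n" and free: "digraph_free P13 D"
    using D by (simp_all add: free_digraphs_def)
  interpret pair_digraph D by fact
  have loop: "(v, v) \<notin> parcs D" for v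
    using no_loops' by blast
  have sym: "(v, u) \<in> parcs D" if "(u, v) \<in> parcs D" for u v
  proof (rule dense_symmetric[OF n, where R = "\<lambda>u v. (u, v) \<in> parcs D"])
    show "2 * extremal_size n \<le> arc_count (pverts D) (\<lambda>u v. (u, v) \<in> parcs D)"
      using dense by (simp add: arc_count_parcs[OF pd])
  qed (use that card loop digraph_free_P13D[OF pd free] in \<open>auto dest: in_arcsD1 in_arcsD2\<close>)
  define G where "G = \<lparr>uverts = pverts D, uedges = {{u, v} | u v. (u, v) \<in> parcs D}\<rparr>"
  have edge: "{u, v} \<in> uedges G \<longleftrightarrow> (u, v) \<in> parcs D" for u v
    using sym by (auto simp: G_def doubleton_eq_iff)
  have "simple_graph G"
    using loop by (auto simp: simple_graph_def G_def card_insert_if dest: in_arcsD1 in_arcsD2)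
  moreover have "P13_free_on (uverts G) (\<lambda>u v. {u, v} \<in> uedges G)"
    using digraph_free_P13D[OF pd free] by (simp add: edge) (simp add: G_def)
  ultimately have "G \<in> free_ugraphs n C4"
    using card by (simp add: free_ugraphs_def ugraph_free_C4_iff) (simp add: G_def)
  moreover have "D = double_orientation G"
    by (simp add: double_orientation_def edge) (simp add: G_def)
  ultimately show ?thesis using that by blast
qed

section \<open>Dense C4-free graphs\<close>

definition extremal_arcs :: "(nat \<times> nat) list" where
  "extremal_arcs = extremal_edges @ map (\<lambda>(u, v). (v, u)) extremal_edges"

text \<open>Two vertices have at most one common neighbour.\<close>

lemma distinct_ends_extremal_paths:
  "distinct (map (\<lambda>((a, b), (b', c)). (a, c))
     (filter (\<lambda>((a, b), (b', c)). b = b' \<and> a \<noteq> c) (List.product extremal_arcs extremal_arcs)))"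
  by code_simp

lemma extremal_ugraph:
  assumes "n \<le> 8"
  obtains G where "G \<in> free_ugraphs n C4" "card (uedges G) = extremal_size n"
proof -
  \<comment> \<open>Every pair is increasing, so bounding the larger end keeps exactly the edges
    inside \<open>{..<n}\<close>.\<close>
  define E where "E = filter (\<lambda>(u, v). v < n) extremal_edges"
  define G where "G = \<lparr>uverts = {..<n}, uedges = (\<lambda>(u, v). {u, v}) ` set E\<rparr>"
  have "\<forall>(u, v)\<in>set extremal_edges. u < v"
    by (simp add: extremal_edges_def)
  then have E: "u < v \<and> v < n" if "(u, v) \<in> set E" for u v
    using that by (auto simp: E_def)
  have "simple_graph G"
    by (auto simp: simple_graph_def G_def card_insert_if dest: E)
  moreover have "P13_free_on (uverts G) (\<lambda>u v. {u, v} \<in> uedges G)"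
    unfolding P13_free_on_def
  proof (intro ballI impI notI)
    fix a b c d
    assume dist: "distinct [a, b, c, d]"
      and "{a, b} \<in> uedges G" "{b, c} \<in> uedges G" "{c, d} \<in> uedges G" "{a, d} \<in> uedges G"
    moreover have "(u, v) \<in> set extremal_arcs" if "{u, v} \<in> uedges G" for u v
      using that by (auto simp: G_def E_def extremal_arcs_def doubleton_eq_iff)
    ultimately have "(a, b) \<in> set extremal_arcs" "(b, c) \<in> set extremal_arcs"
      "(a, d) \<in> set extremal_arcs" "(d, c) \<in> set extremal_arcs"
      by (simp_all add: insert_commute)
    \<comment> \<open>The paths through \<open>b\<close> and through \<open>d\<close> have the same
      ends \<open>a\<close> and \<open>c\<close>, so distinctness of the computed list of ends
      identifies them.\<close>
    then have "((a, b), (b, c)) = ((a, d), (d, c))"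
      using distinct_ends_extremal_paths dist unfolding distinct_map
      by (elim conjE inj_onD) auto
    then show False
      using dist by simp
  qed
  moreover have "card (uedges G) = extremal_size n"
  proof -
    have "distinct extremal_edges"
      by (simp add: extremal_edges_def)
    then have "distinct E"
      by (simp add: E_def)
    moreover have "inj_on (\<lambda>(u, v). {u, v}) (set E)"
      by (auto simp: inj_on_def doubleton_eq_iff) (metis E order.asym)+
    ultimately show ?thesis
      by (simp add: G_def card_image distinct_card) (simp add: E_def extremal_size_def)
  qed
  ultimately show ?thesis
    by (intro that[of G]) (auto simp: free_ugraphs_def ugraph_free_C4_iff, simp add: G_def)
qed

section \<open>Equality of the extremal families\<close>

theorem theorem1p9:
  fixes n :: nat
  assumes "1 \<le> n" and "n \<le> 8"
  shows "ex_digraph n P13 = 2 * ex_ugraph n C4 \<and>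
         same_up_to_iso (EX_digraph n P13) (double_orientation ` EX_ugraph n C4)"
proof -
  define m where "m = ex_ugraph n C4"
  have sg: "simple_graph G" if "G \<in> free_ugraphs n C4" for G
    using that by (simp add: free_ugraphs_def)
  \<comment> \<open>The vertex sets vary over infinitely many sets of naturals; a crude bound on the
    sizes makes the maximum one over a finite set.\<close>
  have "card (uedges G) \<le> 2 ^ n" if "G \<in> free_ugraphs n C4" for G
  proof -
    have "uedges G \<subseteq> Pow (uverts G)" "finite (uverts G)" "card (uverts G) = n"
      using that by (auto simp: free_ugraphs_def simple_graph_def)
    then show ?thesis
      by (metis card_Pow card_mono finite_Pow_iff)
  qed
  then have fin: "finite ((\<lambda>G. card (uedges G)) ` free_ugraphs n C4)"
    by (intro finite_subset[OF _ finite_atMost[of "2 ^ n"]]) auto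
  obtain G0 where G0: "G0 \<in> free_ugraphs n C4" "card (uedges G0) = extremal_size n"
    using extremal_ugraph assms(2) by blast
  have le_m: "card (uedges G) \<le> m" if "G \<in> free_ugraphs n C4" for G
    unfolding m_def ex_ugraph_def using fin that by (intro Max_ge) auto
  have "m \<in> (\<lambda>G. card (uedges G)) ` free_ugraphs n C4"
    unfolding m_def ex_ugraph_def using fin G0 by (intro Max_in) auto
  then obtain G1 where G1: "G1 \<in> free_ugraphs n C4" "card (uedges G1) = m"
    by auto
  have size_le: "2 * extremal_size n \<le> 2 * m"
    using le_m[OF G0(1)] G0(2) by simp
  \<comment> \<open>Either \<open>D\<close> has fewer arcs than the doubled witness graph, or it is
    itself a double orientation.\<close>
  have arcs_le: "card (parcs D) \<le> 2 * m" if D: "D \<in> free_digraphs n P13" for D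
  proof (cases "2 * extremal_size n \<le> card (parcs D)")
    case True
    then obtain G where "G \<in> free_ugraphs n C4" "D = double_orientation G"
      using dense_digraph_double_orientation[OF assms D] by blast
    then show ?thesis
      using le_m sg by (simp add: card_double_orientation)
  qed (use size_le in simp)
  have ex: "ex_digraph n P13 = 2 * m"
    unfolding ex_digraph_def
  proof (rule Max_eqI)
    show "finite ((\<lambda>G. card (parcs G)) ` free_digraphs n P13)"
      using arcs_le by (intro finite_subset[OF _ finite_atMost[of "2 * m"]]) auto
    show "2 * m \<in> (\<lambda>G. card (parcs G)) ` free_digraphs n P13"
      using G1 sg double_orientation_free card_double_orientation by (metis image_eqI)
  qed (use arcs_le in auto)
  \<comment> \<open>The families coincide as sets, so identity isomorphisms settle the claim up to
    isomorphism.\<close>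
  have EX: "EX_digraph n P13 = double_orientation ` EX_ugraph n C4"
  proof (intro equalityI subsetI)
    fix D assume "D \<in> EX_digraph n P13"
    then have D: "D \<in> free_digraphs n P13" "card (parcs D) = 2 * m"
      by (simp_all add: EX_digraph_def ex)
    then obtain G where G: "G \<in> free_ugraphs n C4" "D = double_orientation G"
      using dense_digraph_double_orientation[OF assms D(1)] size_le by auto
    then have "G \<in> EX_ugraph n C4"
      using D(2) sg by (simp add: EX_ugraph_def card_double_orientation m_def)
    then show "D \<in> double_orientation ` EX_ugraph n C4"
      using G(2) by blast
  next
    fix D assume "D \<in> double_orientation ` EX_ugraph n C4"
    then show "D \<in> EX_digraph n P13"
      using sg double_orientation_free
      by (auto simp: EX_ugraph_def EX_digraph_def ex card_double_orientation m_def)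
  qed
  have refl: "digraph_iso (with_proj D) (with_proj D)" if "D \<in> EX_digraph n P13" for D
  proof -
    have "wf_digraph (with_proj D)"
      using that by (auto simp: EX_digraph_def free_digraphs_def wf_digraph_wp_iff pair_digraph_def
          pair_fin_digraph_def)
    then show ?thesis
      unfolding digraph_iso_def
      by (intro exI[of _ "\<lparr>iso_verts = id, iso_arcs = id, iso_head = snd, iso_tail = fst\<rparr>"])
        (simp add: pre_digraph.digraph_isomorphism_def app_iso_def with_proj_def)
  qed
  show ?thesis
    unfolding same_up_to_iso_def EX[symmetric] using ex refl by (auto simp: m_def)
qed

end
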